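(* Let $T=(v,\{0,1\},P)$ be a binary tag system, and put $\alpha:=c(P(0))$ and $\beta:=c(P(1))$. Define $$Q_v(s):=J\!\left(\frac{s}{2^v}\right),\qquad N(s):=J\!\left(\log_2 s\right),\qquad D(s):=s-2J\!\left(\frac{s}{2}\right),$$ and $$F_T(s):=Q_v(s)+2^{N(s)-v}\left(D(s)(\beta-\alpha)+\alpha-1\right).$$ Then for every binary word $w$ with $\operatorname{len}(w)\ge v$, $$F_T(c(w))=c(\operatorname{step}_T(w)).$$
   Context: Principal values: for $z\in\mathbb{C}\setminus\{0\}$, $\operatorname{Log} z=\log|z|+i\operatorname{Arg} z$ with $\operatorname{Arg} z\in(-\pi,\pi]$. For $x\neq 0$, $x^y:=e^{y\operatorname{Log}x}$; for $a,b\ne0$, $b\neq1$, $\log_b a:=\operatorname{Log}a/\operatorname{Log}b$. For real $u$, $J(u):=u-\frac12+\frac{\operatorname{Log}(e^{2\pi i(1/2-u)})}{2\pi i}$. A tag system $T=(v,\Sigma,P)$ consists of an integer deletion number $v\ge2$, a finite alphabet $\Sigma$, and a production map $P:\Sigma\to\Sigma^*$. From a word $w=w_1\cdots w_n$ with $n\ge v$, one step deletes $w_1\cdots w_v$ and appends $P(w_1)$; that is, $\operatorname{step}_T(w)=w_{v+1}\cdots w_n P(w_1)$. The system halts when $n<v$. A binary tag system is one with $\Sigma=\{0,1\}$. $\operatorname{len}(w)$ is the length of $w$. Encoding: for a binary word $w=w_1\cdots w_n\in\{0,1\}^*$, $c(w):=2^n+\sum_{r=1}^n w_r2^{r-1}$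 (so $c(\varepsilon)=1$ for the empty word $\varepsilon$). *)

theory Defs
  imports "HOL-Analysis.Analysis"
begin

text \<open>
  The library's complex \<^const>\<open>Ln\<close> is the principal branch, with imaginary part in the
  half-open interval from \<open>-pi\<close> (excluded) to \<open>pi\<close> (included), and for \<open>x \<noteq> 0\<close> the complex
  \<open>x powr y\<close> is \<open>exp (y * Ln x)\<close>.  The library's \<^const>\<open>log\<close> is real-valued, hence the
  following complex version.
\<close>

definition clog :: "complex \<Rightarrow> complex \<Rightarrow> complex" where
  "clog b a = Ln a / Ln b"

text \<open>
  \<open>J\<close> is meant for real \<open>u\<close>.  It is declared on the complex numbers because its arguments below
  (such as \<open>clog 2 s\<close>) are complex expressions, although they have real values for \<open>s > 0\<close>.
\<close>

definition J :: "complex \<Rightarrow> complex" where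
  "J u = u - 1/2 + Ln (exp (2 * of_real pi * \<i> * (1/2 - u))) / (2 * of_real pi * \<i>)"

record 'a tag_system =
  deletion :: nat
  alphabet :: "'a set"
  production :: "'a \<Rightarrow> 'a list"

definition is_tag_system :: "'a tag_system \<Rightarrow> bool" where
  "is_tag_system T \<longleftrightarrow> deletion T \<ge> 2 \<and> finite (alphabet T) \<and>
     (\<forall>a\<in>alphabet T. production T a \<in> lists (alphabet T))"

definition is_binary_tag_system :: "nat tag_system \<Rightarrow> bool" where
  "is_binary_tag_system T \<longleftrightarrow> is_tag_system T \<and> alphabet T = {0, 1}"

text \<open>
  Only meaningful when \<open>length w \<ge> deletion T\<close>; on shorter words the system has halted.
\<close>

definition tag_step :: "'a tag_system \<Rightarrow> 'a list \<Rightarrow> 'a list" where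
  "tag_step T w = drop (deletion T) w @ production T (hd w)"

text \<open>
  Letters are numbered from 1 in the formula below, so that the letter \<open>w\<^sub>r\<close> is \<open>w ! (r - 1)\<close>.
\<close>

definition code :: "nat list \<Rightarrow> nat" where
  "code w = 2 ^ length w + (\<Sum>r=1..length w. w ! (r - 1) * 2 ^ (r - 1))"

definition Q :: "nat \<Rightarrow> complex \<Rightarrow> complex" where
  "Q v s = J (s / 2 ^ v)"

definition N :: "complex \<Rightarrow> complex" where
  "N s = J (clog 2 s)"

definition D :: "complex \<Rightarrow> complex" where
  "D s = s - 2 * J (s / 2)"

definition F :: "nat tag_system \<Rightarrow> complex \<Rightarrow> complex" where
  "F T s =
    (let v = deletion T;
         \<alpha> = of_nat (code (production T 0));
         \<beta> = of_nat (code (production T 1))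
     in Q v s + 2 powr (N s - of_nat v) * (D s * (\<beta> - \<alpha>) + \<alpha> - 1))"

end

theory Submission
  imports Defs
begin

text \<open>
  On real arguments \<^const>\<open>J\<close> is the floor function (\<open>J_of_real\<close>): for \<open>u\<close> with fractional
  part \<open>f\<close> the number \<open>2 pi i (1/2 - f)\<close> has imaginary part in the half-open interval of the
  principal logarithm, so \<^const>\<open>Ln\<close> recovers it from its exponential, which does not see the
  integer part of \<open>u\<close>.

  The code of a word reads the word as binary digits, least significant first, topped by a final
  digit \<open>1\<close> that marks the end.  Hence the three auxiliary functions decode the data of a tag step:
  dividing by \<open>2^v\<close> and rounding down removes the first \<open>v\<close> letters (\<open>code_drop\<close>), the parity of
  the code is the first letter, and the rounded binary logarithm is the length of the word
  (\<open>floor_log_code\<close>).  Appending a word \<open>x\<close> to a word of length \<open>m\<close> replaces the marker \<open>2^m\<close> by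
  \<open>2^m\<close> times the code of \<open>x\<close> (\<open>code_append\<close>), that is, it adds \<open>2^m\<close> times the code of \<open>x\<close>
  less one.  With \<open>m = n - v\<close> this is the second summand of \<^const>\<open>F\<close>, in which the first letter
  interpolates linearly between the two possible values of the code of \<open>x\<close>.
\<close>

lemma J_of_real: "J (of_real u) = of_int \<lfloor>u\<rfloor>"
proof -
  have "exp (2 * of_real pi * \<i> * (1/2 - of_real u)) = exp (of_real (pi * (1 - 2 * frac u)) * \<i>)"
    unfolding exp_eq by (rule exI[of _ "- \<lfloor>u\<rfloor>"]) (simp add: frac_def algebra_simps)
  moreover have "Ln (exp (of_real (pi * (1 - 2 * frac u)) * \<i>)) = of_real (pi * (1 - 2 * frac u)) * \<i>"
  proof (rule Ln_exp)
    have "pi * frac u < pi * 1" "0 \<le> pi * frac u"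
      using frac_lt_1[of u] frac_ge_0[of u] by (auto intro: mult_strict_left_mono)
    then show "- pi < Im (of_real (pi * (1 - 2 * frac u)) * \<i>)"
      and "Im (of_real (pi * (1 - 2 * frac u)) * \<i>) \<le> pi"
      by (simp_all add: algebra_simps)
  qed
  ultimately have "J (of_real u) = of_real u - 1/2 + of_real (1/2 - frac u)"
    unfolding J_def by (simp only:) (simp add: field_simps)
  also have "\<dots> = of_int \<lfloor>u\<rfloor>"
    by (simp add: frac_def)
  finally show ?thesis .
qed

lemma J_divide_nat: "J (of_nat a / of_nat b) = of_nat (a div b)"
  using J_of_real[of "real a / real b"] by (simp add: floor_divide_of_nat_eq)

lemma code_Nil [simp]: "code [] = 1"
  by (simp add: code_def)

lemma code_Cons [simp]: "code (a # w) = a + 2 * code w"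
proof -
  have "code u = 2 ^ length u + (\<Sum>i<length u. u ! i * 2 ^ i)" for u
    by (simp add: code_def sum.atLeast1_atMost_eq)
  then show ?thesis
    by (simp add: sum.lessThan_Suc_shift sum_distrib_left algebra_simps del: sum.lessThan_Suc)
qed

text \<open>
  The marker of \<open>u\<close> is the one digit of \<open>code u\<close> that disappears when \<open>x\<close> follows; it stands
  on the left to avoid subtraction of natural numbers.
\<close>

lemma code_append: "code (u @ x) + 2 ^ length u = code u + 2 ^ length u * code x"
  by (induction u) (simp_all add: algebra_simps)

lemma code_pos: "code w > 0"
  by (induction w) simp_all

lemma code_bounds:
  assumes "w \<in> lists {0, 1}"
  shows "2 ^ length w \<le> code w" and "code w < 2 ^ Suc (length w)"
  using assms by (induction w) auto

lemma code_drop: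
  assumes "w \<in> lists {0, 1}" and "k \<le> length w"
  shows "code w div 2 ^ k = code (drop k w)"
  using assms
proof (induction w arbitrary: k)
  case (Cons a w)
  then show ?case
    by (cases k) (auto simp: div_mult2_eq)
qed simp

lemma floor_log_code:
  assumes "w \<in> lists {0, 1}"
  shows "\<lfloor>log 2 (real (code w))\<rfloor> = int (length w)"
  using floor_log_nat_eq_powr_iff[of 2 "code w" "length w"] code_bounds[OF assms]
  by (simp add: code_pos)

lemma clog_of_real:
  assumes "x > 0" and "b > 0"
  shows "clog (of_real b) (of_real x) = of_real (log b x)"
  using assms by (simp add: clog_def log_def Ln_of_real)

lemma N_code:
  assumes "w \<in> lists {0, 1}"
  shows "N (of_nat (code w)) = of_nat (length w)"
proof -
  have "clog 2 (of_nat (code w)) = of_real (log 2 (real (code w)))"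
    using clog_of_real[of "real (code w)" 2] code_pos[of w] by simp
  then show ?thesis
    by (simp add: N_def J_of_real floor_log_code[OF assms])
qed

lemma Q_of_nat: "Q v (of_nat a) = of_nat (a div 2 ^ v)"
  using J_divide_nat[of a "2 ^ v"] by (simp add: Q_def)

lemma D_of_nat: "D (of_nat a) = of_nat (a mod 2)"
proof -
  have "of_nat a = (2 * of_nat (a div 2) + of_nat (a mod 2) :: complex)"
    by (metis mult_div_mod_eq of_nat_add of_nat_mult of_nat_numeral)
  then show ?thesis
    using J_divide_nat[of a 2] by (simp add: D_def)
qed

theorem theorem4p2:
  fixes T :: "nat tag_system" and w :: "nat list"
  assumes "is_binary_tag_system T"
    and "w \<in> lists {0, 1}"
    and "length w \<ge> deletion T"
  shows "F T (of_nat (code w)) = of_nat (code (tag_step T w))"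
proof -
  let ?v = "deletion T"
  let ?m = "length w - ?v"
  let ?p = "\<lambda>a. of_nat (code (production T a)) :: complex"
  have "?v \<ge> 2"
    using assms(1) by (simp add: is_binary_tag_system_def is_tag_system_def)
  then obtain a u where w: "w = a # u"
    using assms(3) by (cases w) auto
  have a: "a = 0 \<or> a = 1"
    using assms(2) w by auto
  have "N (of_nat (code w)) - of_nat ?v = of_nat ?m"
    using N_code[OF assms(2)] assms(3) by (simp add: of_nat_diff)
  then have shift: "2 powr (N (of_nat (code w)) - of_nat ?v) = (2 :: complex) ^ ?m"
    by (simp add: powr_nat)
  have "code w mod 2 = a"
    using a by (auto simp: w)
  then have letter: "D (of_nat (code w)) = of_nat a"
    by (simp add: D_of_nat)
  have "F T (of_nat (code w))
      = of_nat (code (drop ?v w)) + 2 ^ ?m * (of_nat a * (?p 1 - ?p 0) + ?p 0 - 1)"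
    unfolding F_def Let_def shift letter Q_of_nat code_drop[OF assms(2,3)] ..
  also have "\<dots> = of_nat (code (drop ?v w)) + 2 ^ ?m * (?p a - 1)"
    using a by auto
  also have "\<dots> = of_nat (code (drop ?v w @ production T a))"
    using arg_cong[OF code_append[of "drop ?v w" "production T a"], of "of_nat :: nat \<Rightarrow> complex"]
    by (simp add: algebra_simps)
  finally show ?thesis
    by (simp add: tag_step_def w)
qed

end
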